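(* When the potentials are quadratic, $U(x)=V(x)=x^2/2$, the stability condition is equivalent to the asymmetry condition $\dim\mathcal{E}_{M,\mathcal{D}}=n$.
   Context: Let $G=(\mathcal{V},\sim)$ be a finite connected graph with $N=|\mathcal{V}|$ vertices, identified with $\{1,\dots,N\}$, let $n=2N$, and let $\mathcal{D}\subset\mathcal{V}$ be a non-empty subset (damped set). For $(q,p)\in\mathbb{R}^N\times\mathbb{R}^N$ the Hamiltonian is $$H(q,p)=\sum_{i\in\mathcal{V}}\Big(\tfrac12p_i^2+V(q_i)+\tfrac12\sum_{j\sim i}U(q_i-q_j)\Big);$$ for quadratic potentials its unique minimizer is $c_0=0$. Stability condition: the only solution $z_t=(q(t),p(t))$ of the deterministic system $$\dot q_i=p_i,\qquad \dot p_i=-\partial_{q_i}H,\qquad p_i\mathbf{1}_{i\in\mathcal{D}}\equiv0\qquad(i\in\mathcal{V})$$ is $z_t\equiv c_0$. Asymmetry condition: let $$M=\begin{pmatrix}0&I\\-\Gamma&-I_{\mathcal{D}}\end{pmatrix},$$ where $\Gamma=I+\Delta$, $\Delta=D-\Lambda$ is the graph Laplacian ($\Lambda$ the adjacency matrix, $D$ the diagonal degree matrix) and $I_{\mathcal{D}}=\mathrm{diag}(\mathbf{1}_{i\in\mathcal{D}})$. With $(e_1,\dots,e_n)$ the canonical basis of $\mathbb{R}^n$, $\mathcal{E}_{M,\mathcal{D}}=\mathrm{Span}\{M^ke_{i+N}:\ i\in\mathcal{D},\ k\in\mathbb{N}\}$. The asymmetry condition is $\dim\mathcal{E}_{M,\mathcal{D}}=n$.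 *)

theory Defs
  imports "HOL-Analysis.Analysis"
begin

text \<open>The vertex set is a finite type \<open>'v\<close>, so that $N$ is \<open>CARD('v)\<close>,
  configurations are vectors in \<open>real ^ 'v\<close>, and $\mathbb{R}^{2N}$ is \<open>real ^ ('v + 'v)\<close> with
  \<open>Inl i\<close> playing the role of the index $i$ and \<open>Inr i\<close> that of $i + N$.\<close>

definition connected_graph :: "('v :: finite \<Rightarrow> 'v \<Rightarrow> bool) \<Rightarrow> bool" where
  "connected_graph adj \<longleftrightarrow> symp adj \<and> irreflp adj \<and> (\<forall>i j. adj\<^sup>*\<^sup>* i j)"

definition hamiltonian ::
  "(real \<Rightarrow> real) \<Rightarrow> (real \<Rightarrow> real) \<Rightarrow> ('v :: finite \<Rightarrow> 'v \<Rightarrow> bool)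
    \<Rightarrow> real ^ 'v \<Rightarrow> real ^ 'v \<Rightarrow> real" where
  "hamiltonian V U adj q p =
    (\<Sum>i\<in>UNIV. (p $ i)\<^sup>2 / 2 + V (q $ i) + (\<Sum>j | adj j i. U (q $ i - q $ j)) / 2)"

definition hamiltonian_dq ::
  "(real \<Rightarrow> real) \<Rightarrow> (real \<Rightarrow> real) \<Rightarrow> ('v :: finite \<Rightarrow> 'v \<Rightarrow> bool)
    \<Rightarrow> 'v \<Rightarrow> real ^ 'v \<Rightarrow> real ^ 'v \<Rightarrow> real" where
  "hamiltonian_dq V U adj i q p =
    deriv (\<lambda>x. hamiltonian V U adj (\<chi> j. if j = i then x else q $ j) p) (q $ i)"

text \<open>Only meaningful when the Hamiltonian has a unique minimizer; see
  \<open>energy_minimizer_quadratic\<close> below for the quadratic case.\<close>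

definition energy_minimizer ::
  "(real \<Rightarrow> real) \<Rightarrow> (real \<Rightarrow> real) \<Rightarrow> ('v :: finite \<Rightarrow> 'v \<Rightarrow> bool)
    \<Rightarrow> (real ^ 'v) \<times> (real ^ 'v)" where
  "energy_minimizer V U adj =
    (THE c. \<forall>q p. (q, p) \<noteq> c \<longrightarrow>
       hamiltonian V U adj (fst c) (snd c) < hamiltonian V U adj q p)"

text \<open>Trajectories are considered for times $t \ge 0$; derivatives at $0$ are one-sided.\<close>

definition frozen_solution ::
  "(real \<Rightarrow> real) \<Rightarrow> (real \<Rightarrow> real) \<Rightarrow> ('v :: finite \<Rightarrow> 'v \<Rightarrow> bool) \<Rightarrow> 'v set
    \<Rightarrow> (real \<Rightarrow> real ^ 'v) \<Rightarrow> (real \<Rightarrow> real ^ 'v) \<Rightarrow> bool" where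
  "frozen_solution V U adj \<D> q p \<longleftrightarrow>
    (\<forall>t\<ge>0. \<forall>i.
       ((\<lambda>s. q s $ i) has_real_derivative p t $ i) (at t within {0..}) \<and>
       ((\<lambda>s. p s $ i) has_real_derivative - hamiltonian_dq V U adj i (q t) (p t))
         (at t within {0..}) \<and>
       p t $ i * indicator \<D> i = 0)"

definition stability_condition ::
  "(real \<Rightarrow> real) \<Rightarrow> (real \<Rightarrow> real) \<Rightarrow> ('v :: finite \<Rightarrow> 'v \<Rightarrow> bool) \<Rightarrow> 'v set \<Rightarrow> bool" where
  "stability_condition V U adj \<D> \<longleftrightarrow>
    (\<forall>q p. frozen_solution V U adj \<D> q p \<longrightarrow>
       (\<forall>t\<ge>0. (q t, p t) = energy_minimizer V U adj))"

definition adjacency_matrix :: "('v :: finite \<Rightarrow> 'v \<Rightarrow> bool) \<Rightarrow> real ^ 'v ^ 'v" where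
  "adjacency_matrix adj = (\<chi> i j. if adj i j then 1 else 0)"

definition degree_matrix :: "('v :: finite \<Rightarrow> 'v \<Rightarrow> bool) \<Rightarrow> real ^ 'v ^ 'v" where
  "degree_matrix adj = (\<chi> i j. if i = j then real (card {k. adj i k}) else 0)"

definition graph_laplacian :: "('v :: finite \<Rightarrow> 'v \<Rightarrow> bool) \<Rightarrow> real ^ 'v ^ 'v" where
  "graph_laplacian adj = degree_matrix adj - adjacency_matrix adj"

definition Gamma_matrix :: "('v :: finite \<Rightarrow> 'v \<Rightarrow> bool) \<Rightarrow> real ^ 'v ^ 'v" where
  "Gamma_matrix adj = mat 1 + graph_laplacian adj"

definition damping_matrix :: "'v :: finite set \<Rightarrow> real ^ 'v ^ 'v" where
  "damping_matrix \<D> = (\<chi> i j. if i = j then indicator \<D> i else 0)"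

definition block_matrix ::
  "real ^ 'v ^ 'v \<Rightarrow> real ^ 'v ^ 'v \<Rightarrow> real ^ 'v ^ 'v \<Rightarrow> real ^ 'v ^ 'v
    \<Rightarrow> real ^ ('v :: finite + 'v) ^ ('v + 'v)" where
  "block_matrix A B C D = (\<chi> r c.
    case r of
      Inl i \<Rightarrow> (case c of Inl j \<Rightarrow> A $ i $ j | Inr j \<Rightarrow> B $ i $ j)
    | Inr i \<Rightarrow> (case c of Inl j \<Rightarrow> C $ i $ j | Inr j \<Rightarrow> D $ i $ j))"

definition M_matrix ::
  "('v :: finite \<Rightarrow> 'v \<Rightarrow> bool) \<Rightarrow> 'v set \<Rightarrow> real ^ ('v + 'v) ^ ('v + 'v)" where
  "M_matrix adj \<D> = block_matrix 0 (mat 1) (- Gamma_matrix adj) (- damping_matrix \<D>)"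

text \<open>The power $M^k$ is written as the iterated action of $M$ on vectors, since \<open>M ^ k\<close> would
  denote the entrywise power.\<close>

definition E_space ::
  "real ^ ('v + 'v) ^ ('v + 'v) \<Rightarrow> 'v :: finite set \<Rightarrow> (real ^ ('v + 'v)) set" where
  "E_space M \<D> = span {((\<lambda>x. M *v x) ^^ k) (axis (Inr i) 1) | i k. i \<in> \<D>}"

definition asymmetry_condition :: "('v :: finite \<Rightarrow> 'v \<Rightarrow> bool) \<Rightarrow> 'v set \<Rightarrow> bool" where
  "asymmetry_condition adj \<D> \<longleftrightarrow> dim (E_space (M_matrix adj \<D>) \<D>) = 2 * CARD('v)"

lemma hamiltonian_quadratic_pos:
  fixes q p :: "real ^ 'v :: finite"
  assumes "(q, p) \<noteq> 0"
  shows "0 < hamiltonian (\<lambda>x. x\<^sup>2 / 2) (\<lambda>x. x\<^sup>2 / 2) adj q p"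
proof -
  let ?f = "\<lambda>i. (p $ i)\<^sup>2 / 2 + (q $ i)\<^sup>2 / 2 + (\<Sum>j | adj j i. (q $ i - q $ j)\<^sup>2 / 2) / 2"
  obtain i where i: "q $ i \<noteq> 0 \<or> p $ i \<noteq> 0"
    using assms by (auto simp: vec_eq_iff zero_prod_def)
  have c: "0 \<le> (\<Sum>j | adj j k. (q $ k - q $ j)\<^sup>2 / 2)" for k
    by (intro sum_nonneg) auto
  have "0 < (p $ i)\<^sup>2 / 2 + (q $ i)\<^sup>2 / 2"
    using i by (auto intro: add_pos_nonneg add_nonneg_pos)
  then have "0 < ?f i"
    using c[of i] by simp
  moreover have "0 \<le> ?f k" for k
    using c[of k] by simp
  ultimately have "0 < sum ?f UNIV"
    by (intro sum_pos2[of UNIV i]) auto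
  then show ?thesis
    by (simp add: hamiltonian_def)
qed

lemma energy_minimizer_quadratic:
  "energy_minimizer (\<lambda>x. x\<^sup>2 / 2) (\<lambda>x. x\<^sup>2 / 2) adj = (0 :: (real ^ 'v) \<times> (real ^ 'v :: finite))"
proof -
  let ?H = "hamiltonian (\<lambda>x. x\<^sup>2 / 2) (\<lambda>x. x\<^sup>2 / 2) adj :: real ^ 'v \<Rightarrow> real ^ 'v \<Rightarrow> real"
  have z: "?H 0 0 = 0"
    by (simp add: hamiltonian_def)
  show ?thesis
    unfolding energy_minimizer_def
  proof (rule the_equality)
    show "\<forall>q p. (q, p) \<noteq> 0 \<longrightarrow> ?H (fst 0) (snd 0) < ?H q p"
      using hamiltonian_quadratic_pos[where adj = adj] z by simp
  next
    fix c :: "(real ^ 'v) \<times> (real ^ 'v)"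
    assume a: "\<forall>q p. (q, p) \<noteq> c \<longrightarrow> ?H (fst c) (snd c) < ?H q p"
    show "c = 0"
    proof (rule ccontr)
      assume c: "c \<noteq> 0"
      then have "?H (fst c) (snd c) < ?H 0 0"
        using a[rule_format, of 0 0] by (auto simp: zero_prod_def)
      moreover have "0 < ?H (fst c) (snd c)"
        using c by (intro hamiltonian_quadratic_pos) simp
      ultimately show False
        using z by simp
    qed
  qed
qed

end

(*
  Both conditions are equivalent to the Krylov space F = Span {Gamma^k e_i : i in D, k >= 0} being
  all of R^N.

  Asymmetry: M (x, y) = (y, - Gamma x - I_D y), and the range of I_D lies in F, so the span defining
  the asymmetry condition is F x F.

  Stability: for a solution with p_i = 0 on D, differentiating <Gamma^k e_i, p(t)> = 0 twice shows
  inductively that p(t) and Gamma q(t) are orthogonal to F, so both vanish if F is everything.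
  If F is proper, its orthogonal complement is a nonzero invariant subspace of the symmetric positive
  definite matrix Gamma, hence contains an eigenvector v, with eigenvalue l > 0, and
  q(t) = cos (sqrt l t) v is a nonzero solution that stays at rest on D.
*)
theory Submission
  imports Defs
begin

section \<open>The matrix \<open>Gamma_matrix\<close> as a symmetric positive definite form and as
  the gradient of the potential energy\<close>

lemma Gamma_matrix_mult_nth:
  fixes adj :: "'v :: finite \<Rightarrow> 'v \<Rightarrow> bool" and q :: "real ^ 'v"
  shows "(Gamma_matrix adj *v q) $ i = q $ i + (\<Sum>j | adj i j. q $ i - q $ j)"
proof -
  have "(Gamma_matrix adj *v q) $ i =
    (\<Sum>j\<in>UNIV. ((if i = j then q $ j else 0)
       + (if i = j then real (card {k. adj i k}) * q $ j else 0)) - (if adj i j then q $ j else 0))"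
    by (auto simp: Gamma_matrix_def graph_laplacian_def degree_matrix_def adjacency_matrix_def
        matrix_vector_mult_def mat_def algebra_simps intro!: sum.cong)
  also have "\<dots> = q $ i + real (card {k. adj i k}) * q $ i - (\<Sum>j | adj i j. q $ j)"
    by (simp add: sum_subtractf sum.distrib flip: sum.inter_filter)
  finally show ?thesis
    by (simp add: sum_subtractf)
qed

lemma transpose_Gamma_matrix:
  assumes "symp adj"
  shows "transpose (Gamma_matrix adj) = Gamma_matrix adj"
  using assms
  by (auto simp: Gamma_matrix_def graph_laplacian_def degree_matrix_def adjacency_matrix_def
      transpose_def mat_def vec_eq_iff dest: sympD)

lemma inner_Gamma_matrix_mult:
  assumes "symp adj"
  shows "(Gamma_matrix adj *v x) \<bullet> y = x \<bullet> (Gamma_matrix adj *v y)"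
  by (metis assms dot_lmul_matrix transpose_Gamma_matrix transpose_matrix_vector)

text \<open>The quadratic form of the Laplacian is half the sum of (x_i - x_j)^2 over ordered
  adjacent pairs. This bound gives both the sign of eigenvalues and the injectivity of
  \<open>Gamma_matrix\<close>.\<close>

lemma inner_Gamma_matrix_ge:
  assumes "symp adj"
  shows "x \<bullet> x \<le> x \<bullet> (Gamma_matrix adj *v x)"
proof -
  let ?s = "\<Sum>i\<in>UNIV. \<Sum>j\<in>UNIV. if adj i j then x $ i * (x $ i - x $ j) else 0"
  have eq: "x \<bullet> (Gamma_matrix adj *v x) = x \<bullet> x + ?s"
    by (simp add: inner_vec_def Gamma_matrix_mult_nth algebra_simps sum.distrib sum_distrib_left
        flip: sum.inter_filter)
  \<comment> \<open>\<open>?t\<close> is \<open>?s\<close> with the two summation indices exchanged;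
    adding the two completes the squares.\<close>
  let ?t = "\<Sum>i\<in>UNIV. \<Sum>j\<in>UNIV. if adj i j then x $ j * (x $ j - x $ i) else 0"
  have "?s = ?t"
    using assms by (subst sum.swap) (auto intro!: sum.cong dest: sympD)
  moreover have "?s + ?t = (\<Sum>i\<in>UNIV. \<Sum>j\<in>UNIV. if adj i j then (x $ i - x $ j)\<^sup>2 else 0)"
    by (auto simp: power2_eq_square algebra_simps simp flip: sum.distrib intro!: sum.cong)
  moreover have "\<dots> \<ge> 0"
    by (intro sum_nonneg) auto
  ultimately show ?thesis
    using eq by linarith
qed

lemma DERIV_fun_upd_nth:
  "((\<lambda>x. if k = i then x else q $ k) has_real_derivative (if k = i then 1 else 0)) F"
  by (cases "k = i") auto

text \<open>Each edge at i enters the energy once from either end, and the two contributions make up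
  for the factor 1/2 in front of the interaction.\<close>

lemma hamiltonian_dq_quadratic:
  fixes adj :: "'v :: finite \<Rightarrow> 'v \<Rightarrow> bool"
  assumes "symp adj" "irreflp adj"
  shows "hamiltonian_dq (\<lambda>x. x\<^sup>2 / 2) (\<lambda>x. x\<^sup>2 / 2) adj i q p = (Gamma_matrix adj *v q) $ i"
proof -
  let ?d = "\<lambda>k. if k = i then 1 else 0 :: real"
  have filter: "(\<Sum>j | P j. f j) = (\<Sum>j\<in>UNIV. if P j then f j else 0)" for P and f :: "'v \<Rightarrow> real"
    by (simp flip: sum.inter_filter)
  have "((\<lambda>x. hamiltonian (\<lambda>x. x\<^sup>2 / 2) (\<lambda>x. x\<^sup>2 / 2) adj (\<chi> j. if j = i then x else q $ j) p)
    has_real_derivative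
      (\<Sum>k\<in>UNIV. q $ k * ?d k + (\<Sum>j | adj j k. (q $ k - q $ j) * (?d k - ?d j)) / 2)) (at (q $ i))"
    unfolding hamiltonian_def
    by (auto intro!: derivative_eq_intros DERIV_fun_upd_nth sum.cong)
  then have "hamiltonian_dq (\<lambda>x. x\<^sup>2 / 2) (\<lambda>x. x\<^sup>2 / 2) adj i q p =
      (\<Sum>k\<in>UNIV. q $ k * ?d k + (\<Sum>j | adj j k. (q $ k - q $ j) * (?d k - ?d j)) / 2)"
    unfolding hamiltonian_dq_def by (rule DERIV_imp_deriv)
  also have "\<dots> = q $ i + (\<Sum>k\<in>UNIV. \<Sum>j | adj j k. (q $ k - q $ j) * (?d k - ?d j)) / 2"
    by (simp add: sum.distrib sum_divide_distrib if_distrib[of "\<lambda>x. q $ _ * x"] cong: if_cong)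
  \<comment> \<open>Split according to whether the differentiated coordinate is the first or the
    second argument of the interaction; the diagonal terms vanish.\<close>
  also have "(\<Sum>k\<in>UNIV. \<Sum>j | adj j k. (q $ k - q $ j) * (?d k - ?d j)) =
      (\<Sum>k\<in>UNIV. \<Sum>j\<in>UNIV. if k = i then (if adj j k then q $ k - q $ j else 0) else 0)
    + (\<Sum>k\<in>UNIV. \<Sum>j\<in>UNIV. if j = i then (if adj j k then q $ j - q $ k else 0) else 0)"
    unfolding sum.distrib[symmetric]
    by (auto simp: filter algebra_simps intro!: sum.cong)
  also have "(\<Sum>k\<in>UNIV. \<Sum>j\<in>UNIV. if k = i then (if adj j k then q $ k - q $ j else 0) else 0) =
      (\<Sum>j\<in>UNIV. if adj j i then q $ i - q $ j else 0)"
    by (subst sum.swap) simp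
  also have "(\<Sum>k\<in>UNIV. \<Sum>j\<in>UNIV. if j = i then (if adj j k then q $ j - q $ k else 0) else 0) =
      (\<Sum>k\<in>UNIV. if adj i k then q $ i - q $ k else 0)"
    by simp
  also have "(\<lambda>j. adj j i) = adj i"
    using assms(1) by (auto dest: sympD)
  finally show ?thesis
    by (simp add: Gamma_matrix_mult_nth flip: sum.inter_filter)
qed

text \<open>Uniqueness also covers the one-sided derivative at 0, since each t in the half-line is a
  limit of points to its right.\<close>

lemma has_real_derivative_unique_atLeast:
  fixes f :: "real \<Rightarrow> real"
  assumes "(f has_real_derivative a) (at t within {0..})" "(f has_real_derivative b) (at t within {0..})"
    and "t \<ge> 0"
  shows "a = b"
proof (rule vector_derivative_unique_within)
  show "at t within {0..} \<noteq> bot"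
    unfolding trivial_limit_within not_not
    by (rule islimpt_subset[OF islimpt_greaterThanLessThan1[of t "t + 1"]]) (use assms(3) in auto)
qed (use assms in \<open>auto simp: has_real_derivative_iff_has_vector_derivative\<close>)

section \<open>Eigenvectors in invariant subspaces\<close>

text \<open>A maximiser of the Rayleigh quotient on the compact unit sphere of K is an
  eigenvector.\<close>

lemma symmetric_eigenvector_in_subspace:
  fixes f :: "'a :: euclidean_space \<Rightarrow> 'a"
  assumes "linear f" and sym: "\<And>x y. f x \<bullet> y = x \<bullet> f y"
    and K: "subspace K" "f ` K \<subseteq> K" "K \<noteq> {0}"
  obtains v l where "v \<in> K" "v \<noteq> 0" "f v = l *\<^sub>R v"
proof -
  interpret linear f by fact
  let ?S = "sphere 0 1 \<inter> K"
  obtain u where u: "u \<in> K" "u \<noteq> 0"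
    using K(1,3) subspace_0 by blast
  have "compact ?S"
    using K(1) by (intro compact_Int_closed closed_subspace) auto
  moreover have "u /\<^sub>R norm u \<in> ?S"
    using u K(1) by (auto intro: subspace_scale)
  then have "?S \<noteq> {}" by blast
  moreover have "continuous_on ?S (\<lambda>x. x \<bullet> f x)"
    using assms(1) by (intro continuous_intros linear_continuous_on linear_conv_bounded_linear[THEN iffD1])
  ultimately obtain v where v: "v \<in> ?S" and max: "\<And>x. x \<in> ?S \<Longrightarrow> x \<bullet> f x \<le> v \<bullet> f v"
    using continuous_attains_sup[of ?S "\<lambda>x. x \<bullet> f x"] by blast
  define l where "l = v \<bullet> f v"
  \<comment> \<open>Maximality on the sphere extends to all of K by homogeneity.\<close>
  have bound: "x \<bullet> f x \<le> l * (x \<bullet> x)" if "x \<in> K" for x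
  proof (cases "x = 0")
    case False
    then have "x /\<^sub>R norm x \<in> ?S"
      using that K(1) by (auto intro: subspace_scale)
    from max[OF this] False show ?thesis
      by (simp add: scale l_def dot_square_norm field_simps power2_eq_square)
  qed simp
  have stationary: "(l *\<^sub>R v - f v) \<bullet> w = 0" if "w \<in> K" for w
  proof -
    define b c where "b = (l *\<^sub>R v - f v) \<bullet> w" and "c = l * (w \<bullet> w) - w \<bullet> f w"
    have vv: "v \<bullet> v = 1" using v by (simp add: dot_square_norm)
    \<comment> \<open>First variation: \<open>bound\<close> at v + t w is a quadratic in t without
      constant term that is never negative, so its linear coefficient must vanish.\<close>
    have pos: "0 \<le> 2 * t * b + t\<^sup>2 * c" for t
    proof -
      have "v + t *\<^sub>R w \<in> K"
        using v that K(1) by (auto intro: subspace_add subspace_scale)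
      from bound[OF this] have "0 \<le> l * ((v + t *\<^sub>R w) \<bullet> (v + t *\<^sub>R w))
          - (v + t *\<^sub>R w) \<bullet> f (v + t *\<^sub>R w)" by simp
      also have "\<dots> = l * (v \<bullet> v) - v \<bullet> f v + 2 * t * b + t\<^sup>2 * c"
        using sym[of v w]
        by (simp add: b_def c_def add scale inner_simps algebra_simps power2_eq_square
            inner_commute[of w v] inner_commute[of w "f v"])
      finally show ?thesis by (simp add: vv l_def)
    qed
    have "c \<ge> 0" using bound[OF that] by (simp add: c_def)
    have "b = 0"
    proof (rule ccontr)
      assume "b \<noteq> 0"
      \<comment> \<open>Dividing by c + 1 instead of c keeps the test value of t meaningful when c =
        0.\<close>
      have "2 * (- b / (c + 1)) * b + (- b / (c + 1))\<^sup>2 * c = - (b\<^sup>2 * (c + 2)) / (c + 1)\<^sup>2"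
        using \<open>c \<ge> 0\<close> by (simp add: divide_simps power2_eq_square) (simp add: algebra_simps)
      also have "\<dots> < 0"
        using \<open>c \<ge> 0\<close> \<open>b \<noteq> 0\<close> by (simp add: divide_simps zero_less_mult_iff)
      finally show False using pos[of "- b / (c + 1)"] by simp
    qed
    then show ?thesis by (simp add: b_def)
  qed
  \<comment> \<open>By invariance the residual itself lies in K, so it is orthogonal to
    itself.\<close>
  have "l *\<^sub>R v - f v \<in> K"
    using v K by (auto intro: subspace_diff subspace_scale)
  from stationary[OF this] have "f v = l *\<^sub>R v" by simp
  with v show ?thesis by (intro that[of v l]) auto
qed

section \<open>Reduction of the asymmetry condition to a Krylov space\<close>

definition krylov_set :: "real ^ 'v ^ 'v \<Rightarrow> 'v :: finite set \<Rightarrow> (real ^ 'v) set" where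
  "krylov_set A \<D> = {((\<lambda>x. A *v x) ^^ k) (axis i 1) | i k. i \<in> \<D>}"

lemma krylov_set_axis: "i \<in> \<D> \<Longrightarrow> axis i 1 \<in> krylov_set A \<D>"
  unfolding krylov_set_def by (rule CollectI, rule exI[of _ i], rule exI[of _ 0]) simp

lemma krylov_set_mult: "u \<in> krylov_set A \<D> \<Longrightarrow> A *v u \<in> krylov_set A \<D>"
  unfolding krylov_set_def by clarify (metis funpow.simps(2) o_apply)

lemma krylov_set_induct [consumes 1, case_names axis mult]:
  assumes "u \<in> krylov_set A \<D>"
    and "\<And>i. i \<in> \<D> \<Longrightarrow> P (axis i 1)"
    and "\<And>u. u \<in> krylov_set A \<D> \<Longrightarrow> P u \<Longrightarrow> P (A *v u)"
  shows "P u"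
proof -
  obtain i k where u: "u = ((\<lambda>x. A *v x) ^^ k) (axis i 1)" and i: "i \<in> \<D>"
    using assms(1) unfolding krylov_set_def by blast
  have "P (((\<lambda>x. A *v x) ^^ k) (axis i 1))"
  proof (induction k)
    case (Suc k)
    moreover have "((\<lambda>x. A *v x) ^^ k) (axis i 1) \<in> krylov_set A \<D>"
      using i unfolding krylov_set_def by blast
    ultimately show ?case using assms(3) by simp
  qed (use assms(2) i in simp)
  then show ?thesis by (simp add: u)
qed

lemma E_space_eq_span_krylov_set: "E_space M \<D> = span (krylov_set M (Inr ` \<D>))"
  unfolding E_space_def krylov_set_def by (rule arg_cong[where f = span]) auto

lemma span_krylov_set_mult:
  assumes "u \<in> span (krylov_set A \<D>)"
  shows "A *v u \<in> span (krylov_set A \<D>)"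
  using assms
proof (induction rule: span_induct_alt)
  case (step c x y)
  then show ?case
    by (metis krylov_set_mult matrix_vector_mult_add_rdistrib matrix_vector_mult_scaleR
        matrix_vector_right_distrib scalar_mult_eq_scaleR span_add span_base span_scale)
qed (simp add: span_zero)

definition join_vec :: "real ^ 'v \<Rightarrow> real ^ 'v \<Rightarrow> real ^ ('v :: finite + 'v)" where
  "join_vec x y = (\<chi> c. case c of Inl i \<Rightarrow> x $ i | Inr i \<Rightarrow> y $ i)"

lemma join_vec_nth [simp]: "join_vec x y $ Inl i = x $ i" "join_vec x y $ Inr i = y $ i"
  by (simp_all add: join_vec_def)

lemma vec_sum_eq_iff:
  "(z :: 'a ^ ('v :: finite + 'v)) = w \<longleftrightarrow> (\<forall>i. z $ Inl i = w $ Inl i) \<and> (\<forall>i. z $ Inr i = w $ Inr i)"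
  by (metis sum.exhaust vec_eq_iff)

lemma join_vec_exhaust:
  obtains x y where "z = join_vec x y"
  using that[of "\<chi> i. z $ Inl i" "\<chi> i. z $ Inr i"] by (simp add: vec_sum_eq_iff)

lemma join_vec_eq_iff [simp]: "join_vec x y = join_vec x' y' \<longleftrightarrow> x = x' \<and> y = y'"
  by (auto simp: vec_sum_eq_iff vec_eq_iff)

lemma join_vec_add: "join_vec x y + join_vec x' y' = join_vec (x + x') (y + y')"
  by (simp add: vec_sum_eq_iff)

lemma join_vec_scaleR: "c *\<^sub>R join_vec x y = join_vec (c *\<^sub>R x) (c *\<^sub>R y)"
  by (simp add: vec_sum_eq_iff)

lemma join_vec_zero: "join_vec 0 0 = 0"
  by (simp add: vec_sum_eq_iff)

lemma axis_Inr: "axis (Inr i) 1 = join_vec 0 (axis i 1)"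
  by (auto simp: vec_sum_eq_iff axis_def)

lemma M_matrix_mult_join_vec:
  "M_matrix adj \<D> *v join_vec x y = join_vec y (- (Gamma_matrix adj *v x) - damping_matrix \<D> *v y)"
  by (simp add: vec_sum_eq_iff M_matrix_def block_matrix_def matrix_vector_mult_def mat_def
      sum_negf if_distrib[of "\<lambda>x. x * _"] UNIV_Plus_UNIV[symmetric] sum.Plus cong: if_cong
      del: UNIV_Plus_UNIV)

text \<open>This form exhibits the damping term as a combination of starting vectors of the Krylov
  space.\<close>

lemma damping_matrix_mult:
  "damping_matrix \<D> *v y = (\<Sum>i\<in>\<D>. (y $ i) *\<^sub>R axis i 1)"
proof -
  have "(damping_matrix \<D> *v y) $ k = (\<Sum>i\<in>\<D>. (y $ i) *\<^sub>R axis i 1) $ k" for k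
  proof -
    have "(damping_matrix \<D> *v y) $ k = (\<Sum>j\<in>UNIV. if k = j then indicator \<D> k * y $ j else 0)"
      unfolding damping_matrix_def matrix_vector_mult_def by (simp add: if_distrib[of "\<lambda>x. x * _"] cong: if_cong)
    moreover have "(\<Sum>i\<in>\<D>. (y $ i) *\<^sub>R axis i 1) $ k = (if k \<in> \<D> then y $ k else 0)"
      by (simp add: axis_def if_distrib[of "\<lambda>x. y $ _ * x"] cong: if_cong)
    ultimately show ?thesis by (simp add: indicator_def del: sum_component)
  qed
  then show ?thesis by (simp add: vec_eq_iff)
qed

text \<open>The product F x F contains the starting vectors and is invariant under M. Conversely,
  the damping part of M can be cancelled inside the span, after which M moves u from the momentum to
  the position slot and then back as - Gamma u.\<close>

lemma E_space_eq_product: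
  "E_space (M_matrix adj \<D>) \<D> =
    {join_vec x y | x y. x \<in> span (krylov_set (Gamma_matrix adj) \<D>)
       \<and> y \<in> span (krylov_set (Gamma_matrix adj) \<D>)}" (is "?E = ?P")
proof
  let ?M = "M_matrix adj \<D>" and ?G = "Gamma_matrix adj"
  let ?F = "span (krylov_set ?G \<D>)"
  have damp_F: "damping_matrix \<D> *v y \<in> ?F" for y
    unfolding damping_matrix_mult by (intro span_sum span_scale span_base krylov_set_axis)
  have sub: "subspace ?P"
    unfolding subspace_def
  proof (intro conjI ballI allI)
    show "0 \<in> ?P" using span_zero join_vec_zero[symmetric] by blast
  next
    fix z w assume "z \<in> ?P" "w \<in> ?P"
    then show "z + w \<in> ?P" by (clarsimp simp: join_vec_add) (blast intro: span_add)
  next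
    fix c z assume "z \<in> ?P"
    then show "c *\<^sub>R z \<in> ?P" by (clarsimp simp: join_vec_scaleR) (blast intro: span_scale)
  qed
  have "krylov_set ?M (Inr ` \<D>) \<subseteq> ?P"
  proof
    fix z assume "z \<in> krylov_set ?M (Inr ` \<D>)"
    then show "z \<in> ?P"
    proof (induction rule: krylov_set_induct)
      case (axis c)
      then show ?case by (auto simp: axis_Inr intro!: span_zero span_base krylov_set_axis)
    next
      case (mult z)
      then show ?case
        by (auto simp: M_matrix_mult_join_vec intro!: span_diff span_neg span_krylov_set_mult damp_F)
    qed
  qed
  then show "?E \<subseteq> ?P"
    unfolding E_space_eq_span_krylov_set by (rule span_minimal[OF _ sub])
  have M_E: "?M *v z \<in> ?E" if "z \<in> ?E" for z
    using that unfolding E_space_eq_span_krylov_set by (rule span_krylov_set_mult)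
  have E_add: "z + w \<in> ?E" if "z \<in> ?E" "w \<in> ?E" for z w
    using that unfolding E_space_eq_span_krylov_set by (rule span_add)
  have E_scale: "c *\<^sub>R z \<in> ?E" if "z \<in> ?E" for c z
    using that unfolding E_space_eq_span_krylov_set by (rule span_scale)
  have axis_E: "join_vec 0 (axis i 1) \<in> ?E" if "i \<in> \<D>" for i
    unfolding E_space_eq_span_krylov_set axis_Inr[symmetric]
    using that by (intro span_base krylov_set_axis) auto
  have damp_E: "join_vec 0 (damping_matrix \<D> *v y) \<in> ?E" for y
  proof -
    have "join_vec 0 (damping_matrix \<D> *v y) = (\<Sum>i\<in>\<D>. (y $ i) *\<^sub>R join_vec 0 (axis i 1))"
      by (simp add: vec_sum_eq_iff damping_matrix_mult)
    moreover have "\<dots> \<in> ?E"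
      unfolding E_space_eq_span_krylov_set
      by (intro span_sum span_scale) (use axis_E in \<open>simp add: E_space_eq_span_krylov_set\<close>)
    ultimately show ?thesis by simp
  qed
  \<comment> \<open>M (0, u) = (u, - I_D u), and adding (0, I_D u), which is in the span by
    \<open>damp_E\<close>, leaves (u, 0).\<close>
  have left: "join_vec u 0 \<in> ?E" if "join_vec 0 u \<in> ?E" for u
    using E_add[OF M_E[OF that] damp_E[of u]]
    by (simp add: M_matrix_mult_join_vec join_vec_add)
  have right: "join_vec 0 u \<in> ?E" if "u \<in> krylov_set ?G \<D>" for u
    using that
  proof (induction rule: krylov_set_induct)
    case (axis i)
    then show ?case by (rule axis_E)
  next
    case (mult u)
    \<comment> \<open>Since M (u, 0) = (0, - Gamma u), two applications of M with the damping
      removed act as one application of Gamma, up to sign.\<close>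
    from E_scale[OF M_E[OF left[OF mult(2)]], of "-1"] show ?case
      by (simp add: M_matrix_mult_join_vec join_vec_scaleR del: scaleR_minus_left)
  qed
  have right': "join_vec 0 u \<in> ?E" if "u \<in> ?F" for u
    using that
  proof (induction rule: span_induct_alt)
    case base
    then show ?case by (simp add: join_vec_zero E_space_eq_span_krylov_set span_zero)
  next
    case (step c x y)
    from E_add[OF E_scale[OF right[OF step(1)], of c] step(2)] show ?case
      by (simp add: join_vec_scaleR join_vec_add)
  qed
  show "?P \<subseteq> ?E"
    using E_add[OF left[OF right'] right'] by (auto simp: join_vec_add)
qed

text \<open>A subspace of full dimension is the whole space, and F x F is the whole space exactly
  when F is.\<close>

lemma asymmetry_condition_iff:
  "asymmetry_condition adj \<D> \<longleftrightarrow> span (krylov_set (Gamma_matrix adj) \<D>) = UNIV"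
proof -
  let ?E = "E_space (M_matrix adj \<D>) \<D>" and ?F = "span (krylov_set (Gamma_matrix adj) \<D>)"
  have "asymmetry_condition adj \<D> \<longleftrightarrow> ?E = UNIV"
    using dim_eq_full[of ?E]
    by (simp add: asymmetry_condition_def E_space_eq_span_krylov_set span_span mult_2 del: dim_span)
  also have "\<dots> \<longleftrightarrow> ?F = UNIV"
  proof
    assume E: "?E = UNIV"
    have "x \<in> ?F" for x
    proof -
      have "join_vec x 0 \<in> ?E" using E by simp
      then show ?thesis unfolding E_space_eq_product by auto
    qed
    then show "?F = UNIV" by blast
  next
    assume "?F = UNIV"
    then show "?E = UNIV"
      unfolding E_space_eq_product by (auto intro: join_vec_exhaust)
  qed
  finally show ?thesis .
qed

section \<open>The frozen dynamics\<close>

lemma frozen_solution_quadratic_iff: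
  fixes adj :: "'v :: finite \<Rightarrow> 'v \<Rightarrow> bool"
  assumes "symp adj" "irreflp adj"
  shows "frozen_solution (\<lambda>x. x\<^sup>2 / 2) (\<lambda>x. x\<^sup>2 / 2) adj \<D> q p \<longleftrightarrow>
    (\<forall>t\<ge>0. \<forall>i.
       ((\<lambda>s. q s $ i) has_real_derivative p t $ i) (at t within {0..}) \<and>
       ((\<lambda>s. p s $ i) has_real_derivative - (Gamma_matrix adj *v q t) $ i) (at t within {0..}) \<and>
       (i \<in> \<D> \<longrightarrow> p t $ i = 0))"
  by (auto simp: frozen_solution_def hamiltonian_dq_quadratic[OF assms] indicator_def)

text \<open>Differentiating u . p = 0 gives u . Gamma q = 0, that is (Gamma u) . q = 0 by symmetry;
  differentiating once more gives (Gamma u) . p = 0, the next Krylov vector.\<close>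

lemma frozen_solution_orthogonal_krylov_set:
  fixes adj :: "'v :: finite \<Rightarrow> 'v \<Rightarrow> bool"
  assumes adj: "symp adj" "irreflp adj"
    and sol: "frozen_solution (\<lambda>x. x\<^sup>2 / 2) (\<lambda>x. x\<^sup>2 / 2) adj \<D> q p"
    and u: "u \<in> krylov_set (Gamma_matrix adj) \<D>" and t: "t \<ge> 0"
  shows "u \<bullet> p t = 0" "u \<bullet> (Gamma_matrix adj *v q t) = 0"
proof -
  let ?G = "Gamma_matrix adj"
  note sol' = sol[unfolded frozen_solution_quadratic_iff[OF adj]]
  have dq: "((\<lambda>s. w \<bullet> q s) has_real_derivative w \<bullet> p s) (at s within {0..})" if "s \<ge> 0" for w s
    unfolding inner_vec_def using sol' that
    by (auto intro!: derivative_eq_intros sum.cong)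
  have dp: "((\<lambda>s. w \<bullet> p s) has_real_derivative - (w \<bullet> (?G *v q s))) (at s within {0..})"
    if "s \<ge> 0" for w s
    unfolding inner_vec_def sum_negf[symmetric] using sol' that
    by (auto intro!: derivative_eq_intros sum.cong)
  have const: "d = 0" if "(f has_real_derivative d) (at s within {0..})" "\<And>s. s \<ge> 0 \<Longrightarrow> f s = 0" "s \<ge> 0"
    for f d and s :: real
  proof (rule has_real_derivative_unique_atLeast[OF that(1)])
    show "(f has_real_derivative 0) (at s within {0..})"
      by (rule has_field_derivative_transform_within[of "\<lambda>_. 0" _ _ _ 1]) (use that in auto)
  qed (use that in auto)
  have q_zero: "w \<bullet> (?G *v q s) = 0" if "\<And>s. s \<ge> 0 \<Longrightarrow> w \<bullet> p s = 0" "s \<ge> 0" for w s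
    using const[OF dp that] that by simp
  \<comment> \<open>The time stays arbitrary in the induction, because the hypothesis is
    differentiated and so must hold on the whole half-line.\<close>
  have p_zero: "u \<bullet> p s = 0" if "s \<ge> 0" for s
    using u that
  proof (induction arbitrary: s rule: krylov_set_induct)
    case (axis i)
    then show ?case using sol' by (simp add: inner_axis')
  next
    case (mult u)
    have "(?G *v u) \<bullet> q s = 0" if "s \<ge> 0" for s
      using q_zero[OF mult(2) that] by (simp add: inner_Gamma_matrix_mult[OF adj(1)])
    from const[OF dq this] mult show ?case by blast
  qed
  show "u \<bullet> p t = 0" "u \<bullet> (?G *v q t) = 0"
    using p_zero q_zero t by blast+
qed

text \<open>A normal mode with frequency \<open>sqrt l\<close>: every coordinate satisfies q'' = - l
  q, and the sites where v vanishes never move.\<close>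

lemma frozen_solution_eigenvector:
  fixes adj :: "'v :: finite \<Rightarrow> 'v \<Rightarrow> bool"
  assumes adj: "symp adj" "irreflp adj"
    and v: "Gamma_matrix adj *v v = l *\<^sub>R v" "\<And>i. i \<in> \<D> \<Longrightarrow> v $ i = 0" and "l \<ge> 0"
  shows "frozen_solution (\<lambda>x. x\<^sup>2 / 2) (\<lambda>x. x\<^sup>2 / 2) adj \<D>
    (\<lambda>t. cos (sqrt l * t) *\<^sub>R v) (\<lambda>t. (- sqrt l * sin (sqrt l * t)) *\<^sub>R v)"
  unfolding frozen_solution_quadratic_iff[OF adj] matrix_vector_mult_scaleR v(1)
  using \<open>l \<ge> 0\<close> v(2)
  by (auto intro!: derivative_eq_intros simp: real_sqrt_mult_self)

lemma stability_condition_quadratic_iff: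
  fixes adj :: "'v :: finite \<Rightarrow> 'v \<Rightarrow> bool"
  assumes adj: "symp adj" "irreflp adj"
  shows "stability_condition (\<lambda>x. x\<^sup>2 / 2) (\<lambda>x. x\<^sup>2 / 2) adj \<D> \<longleftrightarrow>
    span (krylov_set (Gamma_matrix adj) \<D>) = UNIV"
proof
  let ?Z = "krylov_set (Gamma_matrix adj) \<D>" and ?G = "Gamma_matrix adj"
  assume stable: "stability_condition (\<lambda>x. x\<^sup>2 / 2) (\<lambda>x. x\<^sup>2 / 2) adj \<D>"
  show "span ?Z = UNIV"
  proof (rule ccontr)
    assume "span ?Z \<noteq> UNIV"
    then obtain a where a: "a \<noteq> 0" "\<And>x. x \<in> span ?Z \<Longrightarrow> a \<bullet> x = 0"
      using span_not_UNIV_orthogonal by blast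
    \<comment> \<open>K is the orthogonal complement of the Krylov space; symmetry of Gamma turns
      invariance of the generators into invariance of K.\<close>
    define K where "K = {w. \<forall>u\<in>?Z. u \<bullet> w = 0}"
    have "subspace K"
      by (auto simp: K_def subspace_def inner_simps)
    moreover have "(\<lambda>x. ?G *v x) ` K \<subseteq> K"
      by (auto simp: K_def krylov_set_mult simp flip: inner_Gamma_matrix_mult[OF adj(1)])
    moreover have "a \<in> K"
      using a(2) by (auto simp: K_def inner_commute span_base)
    with a(1) have "K \<noteq> {0}" by blast
    ultimately obtain v l where v: "v \<in> K" "v \<noteq> 0" "?G *v v = l *\<^sub>R v"
      using symmetric_eigenvector_in_subspace[of "\<lambda>x. ?G *v x" K]
        inner_Gamma_matrix_mult[OF adj(1)] matrix_vector_mul_linear by blast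
    have "v \<bullet> v \<le> l * (v \<bullet> v)"
      using inner_Gamma_matrix_ge[OF adj(1), of v] v(3) by simp
    then have "l \<ge> 0"
      using v(2) by simp
    moreover have "v $ i = 0" if "i \<in> \<D>" for i
      using v(1) krylov_set_axis[OF that, of ?G] by (auto simp: K_def inner_axis')
    ultimately have "frozen_solution (\<lambda>x. x\<^sup>2 / 2) (\<lambda>x. x\<^sup>2 / 2) adj \<D>
        (\<lambda>t. cos (sqrt l * t) *\<^sub>R v) (\<lambda>t. (- sqrt l * sin (sqrt l * t)) *\<^sub>R v)"
      using frozen_solution_eigenvector[OF adj v(3)] by blast
    \<comment> \<open>At time 0 the mode is at position v with zero momentum, away from the
      minimizer.\<close>
    with stable have "(cos (sqrt l * 0) *\<^sub>R v, (- sqrt l * sin (sqrt l * 0)) *\<^sub>R v) = 0"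
      unfolding stability_condition_def energy_minimizer_quadratic by blast
    with v(2) show False by (simp add: zero_prod_def)
  qed
next
  let ?Z = "krylov_set (Gamma_matrix adj) \<D>" and ?G = "Gamma_matrix adj"
  assume span: "span ?Z = UNIV"
  \<comment> \<open>Orthogonality to the generators passes to their span, which contains w
    itself.\<close>
  have zero: "w = 0" if "\<And>u. u \<in> ?Z \<Longrightarrow> u \<bullet> w = 0" for w
  proof -
    have "orthogonal w w"
      using orthogonal_to_span[of w ?Z w] that span by (simp add: orthogonal_def inner_commute)
    then show ?thesis by (simp add: orthogonal_def)
  qed
  show "stability_condition (\<lambda>x. x\<^sup>2 / 2) (\<lambda>x. x\<^sup>2 / 2) adj \<D>"
    unfolding stability_condition_def energy_minimizer_quadratic
  proof (intro allI impI)
    fix q p :: "real \<Rightarrow> real ^ 'v" and t :: real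
    assume sol: "frozen_solution (\<lambda>x. x\<^sup>2 / 2) (\<lambda>x. x\<^sup>2 / 2) adj \<D> q p" and t: "0 \<le> t"
    have "p t = 0" "?G *v q t = 0"
      using frozen_solution_orthogonal_krylov_set[OF adj sol _ t] by (auto intro: zero)
    \<comment> \<open>The lower bound on the quadratic form makes the kernel of Gamma
      trivial.\<close>
    moreover from this have "q t \<bullet> q t \<le> 0"
      using inner_Gamma_matrix_ge[OF adj(1), of "q t"] by simp
    then have "q t = 0" by (metis inner_gt_zero_iff not_less)
    ultimately show "(q t, p t) = 0" by (simp add: zero_prod_def)
  qed
qed

theorem mainTheorem6:
  fixes adj :: "'v :: finite \<Rightarrow> 'v \<Rightarrow> bool"
    and \<D> :: "'v set"
    and U V :: "real \<Rightarrow> real"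
  assumes "connected_graph adj"
    and "\<D> \<noteq> {}"
    and "U = (\<lambda>x. x\<^sup>2 / 2)"
    and "V = (\<lambda>x. x\<^sup>2 / 2)"
  shows "stability_condition V U adj \<D> \<longleftrightarrow> asymmetry_condition adj \<D>"
  using assms
  by (simp add: connected_graph_def stability_condition_quadratic_iff asymmetry_condition_iff)

end
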